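(* Let $\mathcal A$ be a unital $C^*$-algebra, $\mathcal L=\mathcal A_{\mathrm{sa}}$ its self-adjoint part regarded as a Lie--Jordan Banach algebra, $\mathcal J$ a closed Jordan ideal of $\mathcal L$, $\mathcal N_{\mathcal J}=\{a\in\mathcal L : [a,\mathcal J]\subset\mathcal J\}$, and $\widetilde{\mathcal L}=\mathcal N_{\mathcal J}/(\mathcal N_{\mathcal J}\cap\mathcal J)$ the reduced Lie--Jordan Banach algebra. Then there is a one-to-one correspondence between the states $\widetilde\omega$ of $\widetilde{\mathcal L}$ and the $\mathcal N_{\mathcal J}^0$-equivalence classes of states $\omega\in\mathcal S((\mathcal N_{\mathcal J}\cap\mathcal J)^0)\subset\mathcal S(\mathcal L)$.
   Context: $\mathcal L=\mathcal A_{\mathrm{sa}}$ has Jordan product $a\circ b=\frac12(ab+ba)$, bracket $[a,b]=i\lambda(ab-ba)$ for a fixed nonzero $\lambda\in\mathbb R$, and the norm of $\mathcal A$. A Jordan ideal is a linear subspace $\mathcal J$ with $\mathcal L\circ\mathcal J\subset\mathcal J$. $\widetilde{\mathcal L}$ carries the induced operations, the quotient norm and the unit $\mathbb 1+\mathcal N_{\mathcal J}\cap\mathcal J$. A state of a unital Lie--Jordan Banach algebra is a real linear functional $\rho$ with $\rho(\mathbb 1)=1$ and $\rho(a\circ a)\ge 0$ for all $a$; $\mathcal S(\cdot)$ denotes the set of states. For a subspace $X\subset\mathcal L$, $X^0$ denotes its annihilator in the dual of $\mathcal L$, and $\mathcal S((\mathcal N_{\mathcal J}\cap\mathcal J)^0)$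 is the set of states of $\mathcal L$ vanishing on $\mathcal N_{\mathcal J}\cap\mathcal J$. Two such states are $\mathcal N_{\mathcal J}^0$-equivalent if their difference lies in $\mathcal N_{\mathcal J}^0$, i.e. they have the same image under the projection $(\mathcal N_{\mathcal J}\cap\mathcal J)^0\to(\mathcal N_{\mathcal J}\cap\mathcal J)^0/\mathcal N_{\mathcal J}^0$. *)

theory Defs
  imports "HOL-Analysis.Analysis"
begin

text \<open>
  Unital complex \<open>C\<^sup>*\<close>-algebras.  The real Banach algebra structure comes from the library classes;
  complex scalars and the involution are added.  The class \<open>monoid_mult\<close> is used for the unit instead
  of \<open>ring_1\<close> so that the zero algebra is not excluded (the \<open>C\<^sup>*\<close>-identity gives \<open>norm 1 = 1\<close>
  whenever \<open>1 \<noteq> 0\<close>).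
\<close>

class unital_cstar_algebra = banach + real_normed_algebra + monoid_mult +
  fixes scaleC :: "complex \<Rightarrow> 'a \<Rightarrow> 'a" (infixr "*\<^sub>C" 75)
    and star :: "'a \<Rightarrow> 'a"
  assumes scaleC_add_right: "c *\<^sub>C (x + y) = c *\<^sub>C x + c *\<^sub>C y"
    and scaleC_add_left: "(c + d) *\<^sub>C x = c *\<^sub>C x + d *\<^sub>C x"
    and scaleC_scaleC: "c *\<^sub>C (d *\<^sub>C x) = (c * d) *\<^sub>C x"
    and scaleR_scaleC: "r *\<^sub>R x = complex_of_real r *\<^sub>C x"
    and mult_scaleC_left: "(c *\<^sub>C x) * y = c *\<^sub>C (x * y)"
    and mult_scaleC_right: "x * (c *\<^sub>C y) = c *\<^sub>C (x * y)"
    and norm_scaleC: "norm (c *\<^sub>C x) = cmod c * norm x"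
    and star_add: "star (x + y) = star x + star y"
    and star_scaleC: "star (c *\<^sub>C x) = cnj c *\<^sub>C star x"
    and star_mult: "star (x * y) = star y * star x"
    and star_star: "star (star x) = x"
    and cstar_identity: "norm (star x * x) = (norm x)\<^sup>2"

record 'b lie_jordan =
  lj_carrier :: "'b set"
  lj_add :: "'b \<Rightarrow> 'b \<Rightarrow> 'b"
  lj_scale :: "real \<Rightarrow> 'b \<Rightarrow> 'b"
  lj_jordan :: "'b \<Rightarrow> 'b \<Rightarrow> 'b"
  lj_bracket :: "'b \<Rightarrow> 'b \<Rightarrow> 'b"
  lj_norm :: "'b \<Rightarrow> real"
  lj_unit :: 'b

text \<open>
  A functional on \<open>M\<close> is a function on the carrier; as an element of a function type it is made
  unique by requiring it to be \<open>undefined\<close> outside the carrier (\<open>extensional\<close>).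
\<close>

definition linear_functionals :: "'b lie_jordan \<Rightarrow> ('b \<Rightarrow> real) set" where
  "linear_functionals M = {\<rho> \<in> extensional (lj_carrier M).
     (\<forall>x\<in>lj_carrier M. \<forall>y\<in>lj_carrier M. \<rho> (lj_add M x y) = \<rho> x + \<rho> y) \<and>
     (\<forall>r. \<forall>x\<in>lj_carrier M. \<rho> (lj_scale M r x) = r * \<rho> x)}"

definition states :: "'b lie_jordan \<Rightarrow> ('b \<Rightarrow> real) set" where
  "states M = {\<rho> \<in> linear_functionals M.
     \<rho> (lj_unit M) = 1 \<and> (\<forall>x\<in>lj_carrier M. 0 \<le> \<rho> (lj_jordan M x x))}"

definition dual :: "'b lie_jordan \<Rightarrow> ('b \<Rightarrow> real) set" where
  "dual M = {\<phi> \<in> linear_functionals M.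
     \<exists>K. \<forall>x\<in>lj_carrier M. \<bar>\<phi> x\<bar> \<le> K * lj_norm M x}"

definition annihilator :: "'b lie_jordan \<Rightarrow> 'b set \<Rightarrow> ('b \<Rightarrow> real) set" where
  "annihilator M X = {\<phi> \<in> dual M. \<forall>x\<in>X. \<phi> x = 0}"

definition selfadjoint :: "'a::unital_cstar_algebra set" where
  "selfadjoint = {a. star a = a}"

definition jordan_prod :: "'a::unital_cstar_algebra \<Rightarrow> 'a \<Rightarrow> 'a" where
  "jordan_prod a b = (1/2) *\<^sub>R (a * b + b * a)"

definition lie_bracket :: "real \<Rightarrow> 'a::unital_cstar_algebra \<Rightarrow> 'a \<Rightarrow> 'a" where
  "lie_bracket lam a b = (\<i> * complex_of_real lam) *\<^sub>C (a * b - b * a)"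

definition sa_algebra :: "real \<Rightarrow> 'a::unital_cstar_algebra lie_jordan" where
  "sa_algebra lam =
    \<lparr> lj_carrier = selfadjoint,
      lj_add = (+),
      lj_scale = (*\<^sub>R),
      lj_jordan = jordan_prod,
      lj_bracket = lie_bracket lam,
      lj_norm = norm,
      lj_unit = 1 \<rparr>"

definition jordan_ideal :: "'a::unital_cstar_algebra set \<Rightarrow> bool" where
  "jordan_ideal J \<longleftrightarrow> J \<subseteq> selfadjoint \<and> subspace J \<and>
     (\<forall>a\<in>selfadjoint. \<forall>j\<in>J. jordan_prod a j \<in> J)"

definition normalizer :: "real \<Rightarrow> 'a::unital_cstar_algebra set \<Rightarrow> 'a set" where
  "normalizer lam J = {a \<in> selfadjoint. \<forall>j\<in>J. lie_bracket lam a j \<in> J}"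

definition coset :: "real \<Rightarrow> 'a::unital_cstar_algebra set \<Rightarrow> 'a \<Rightarrow> 'a set" where
  "coset lam J a = (\<lambda>k. a + k) ` (normalizer lam J \<inter> J)"

text \<open>
  The operations on cosets are induced by representatives: the union below runs over all
  representatives and collapses to a single coset, since the operations are well defined
  modulo \<open>normalizer lam J \<inter> J\<close> when \<open>J\<close> is a Jordan ideal.
\<close>

definition reduced_algebra :: "real \<Rightarrow> 'a::unital_cstar_algebra set \<Rightarrow> 'a set lie_jordan" where
  "reduced_algebra lam J =
    \<lparr> lj_carrier = coset lam J ` normalizer lam J,
      lj_add = (\<lambda>X Y. \<Union>x\<in>X. \<Union>y\<in>Y. coset lam J (x + y)),
      lj_scale = (\<lambda>r X. \<Union>x\<in>X. coset lam J (r *\<^sub>R x)),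
      lj_jordan = (\<lambda>X Y. \<Union>x\<in>X. \<Union>y\<in>Y. coset lam J (jordan_prod x y)),
      lj_bracket = (\<lambda>X Y. \<Union>x\<in>X. \<Union>y\<in>Y. coset lam J (lie_bracket lam x y)),
      lj_norm = (\<lambda>X. INF x\<in>X. norm x),
      lj_unit = coset lam J 1 \<rparr>"

definition vanishing_states ::
    "real \<Rightarrow> 'a::unital_cstar_algebra set \<Rightarrow> ('a \<Rightarrow> real) set" where
  "vanishing_states lam J =
     {\<omega> \<in> states (sa_algebra lam). \<forall>x \<in> normalizer lam J \<inter> J. \<omega> x = 0}"

definition state_equiv ::
    "real \<Rightarrow> 'a::unital_cstar_algebra set \<Rightarrow> (('a \<Rightarrow> real) \<times> ('a \<Rightarrow> real)) set" where
  "state_equiv lam J =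
     {(\<omega>, \<omega>'). \<omega> \<in> vanishing_states lam J \<and> \<omega>' \<in> vanishing_states lam J \<and>
        restrict (\<lambda>a. \<omega> a - \<omega>' a) selfadjoint \<in> annihilator (sa_algebra lam) (normalizer lam J)}"

end

theory Submission
  imports Defs
begin

text \<open>
  Modulo \<open>\<N>\<^sub>J\<^sup>0\<close> a state of \<open>\<L>\<close> is only its restriction to \<open>\<N>\<^sub>J\<close>, so the point is that every state
  of the quotient, pulled back to a functional \<open>f\<close> on \<open>\<N>\<^sub>J\<close>, extends to a state of \<open>\<L>\<close>.  No spectral
  theory is needed.  If \<open>\<parallel>a\<parallel> < 1\<close>, the binomial series gives a square root \<open>b\<close> of \<open>1 - a\<close> inside the
  closed Jordan algebra \<open>\<N>\<^sub>J\<close>, hence \<open>1 - f a = f (b \<circ> b) \<ge> 0\<close>; this shows \<open>f \<le> \<parallel>\<cdot>\<parallel>\<close>, and the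
  Hahn--Banach theorem extends \<open>f\<close> to \<open>F \<le> \<parallel>\<cdot>\<parallel>\<close>.  For positivity of \<open>F\<close>, take \<open>a\<close> self-adjoint with
  \<open>\<parallel>a\<parallel> < 1\<close> and \<open>b = sqrt (1 - a\<^sup>2)\<close>: then \<open>u = a + \<i> b\<close> is unitary and \<open>b\<close> is its imaginary part, so
  \<open>\<parallel>1 - a\<^sup>2\<parallel> = \<parallel>b\<parallel>\<^sup>2 \<le> 1\<close> and \<open>F (a\<^sup>2) = 1 - F (1 - a\<^sup>2) \<ge> 0\<close>.
\<close>

section \<open>The Hahn--Banach theorem\<close>

text \<open>
  Partial functionals are represented by their graphs, subspaces \<open>G\<close> of \<open>'a \<times> real\<close>.  Being a
  function need not be required: domination by \<open>p\<close> at \<open>\<plusminus> (0, r) \<in> G\<close> already forces \<open>r = 0\<close>.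
\<close>

lemma dominated_graph_unique:
  fixes p :: "'a::real_vector \<Rightarrow> real"
  assumes "subspace G" "\<And>x r. (x, r) \<in> G \<Longrightarrow> r \<le> p x" "p 0 = 0"
    and "(x, r) \<in> G" "(x, s) \<in> G"
  shows "r = s"
proof -
  have "(0, r - s) \<in> G" "(0, s - r) \<in> G"
    using subspace_diff[OF assms(1,4,5)] subspace_diff[OF assms(1,5,4)] by auto
  then show ?thesis using assms(2)[of 0 "r - s"] assms(2)[of 0 "s - r"] assms(3) by linarith
qed

text \<open>Domination on the enlarged graph confines the value \<open>c\<close> at
  \<open>x0\<close> between all \<open>r - p (y - x0)\<close> and all \<open>p (z + x0) - s\<close>.
  Subadditivity of \<open>p\<close> puts every lower bound below every upper bound, so some
  \<open>c\<close> fits.\<close>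

lemma dominated_graph_extend:
  fixes p :: "'a::real_vector \<Rightarrow> real"
  assumes subadd: "\<And>x y. p (x + y) \<le> p x + p y"
    and homog: "\<And>t x. t > 0 \<Longrightarrow> p (t *\<^sub>R x) = t * p x"
    and G: "subspace G" and dom: "\<And>x r. (x, r) \<in> G \<Longrightarrow> r \<le> p x"
  shows "\<exists>c. \<forall>(x, r)\<in>span (insert (x0, c) G). r \<le> p x"
proof -
  define c where "c = (SUP (y, r)\<in>G. r - p (y - x0))"
  have le: "r - p (y - x0) \<le> p (z + x0) - s" if "(y, r) \<in> G" "(z, s) \<in> G" for y r z s
    using dom[of "y + z" "r + s"] subspace_add[OF G that] subadd[of "y - x0" "z + x0"]
    by (simp add: algebra_simps)
  have ne: "(0, 0) \<in> G" using subspace_0[OF G] by (simp add: zero_prod_def)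
  have lower: "r - p (y - x0) \<le> c" if "(y, r) \<in> G" for y r
    unfolding c_def
  proof (rule cSUP_upper2[OF _ that])
    show "bdd_above ((\<lambda>(y, r). r - p (y - x0)) ` G)"
      using le[OF _ ne] by (intro bdd_aboveI[of _ "p (0 + x0) - 0"]) auto
  qed simp
  have upper: "c \<le> p (z + x0) - s" if "(z, s) \<in> G" for z s
    unfolding c_def using ne le[OF _ that] by (intro cSUP_least) auto
  have "s \<le> p x" if "(x, s) \<in> span (insert (x0, c) G)" for x s
  proof -
    have "span G = G" using G by (simp add: span_eq_iff)
    with that obtain k where k: "(x - k *\<^sub>R x0, s - k * c) \<in> G"
      by (auto simp: span_insert)
    \<comment> \<open>Dividing by the absolute value of \<open>k\<close> normalizes the coefficient
      of \<open>x0\<close> to 1 or -1. Positive \<open>k\<close> then uses the upper bound on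
      \<open>c\<close>, negative \<open>k\<close> the lower one.\<close>
    consider "k = 0" | "k > 0" | "k < 0" by linarith
    then show ?thesis
    proof cases
      case 1
      then show ?thesis using k dom by simp
    next
      case 2
      then have "((1/k) *\<^sub>R x - x0, s / k - c) \<in> G"
        using subspace_scale[OF G k, of "1/k"] by (simp add: algebra_simps diff_divide_distrib)
      from upper[OF this] have "s / k \<le> p ((1/k) *\<^sub>R x)" by simp
      then show ?thesis using homog[of "1/k" x] 2 by (simp add: divide_simps)
    next
      case 3
      define m where "m = - k"
      have m: "m > 0" "k = - m" using 3 by (auto simp: m_def)
      have "((1/m) *\<^sub>R x + x0, s / m + c) \<in> G"
        using subspace_scale[OF G k, of "1/m"] m by (simp add: algebra_simps add_divide_distrib)
      from lower[OF this] have "s / m \<le> p ((1/m) *\<^sub>R x)" by simp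
      then show ?thesis using homog[of "1/m" x] m by (simp add: divide_simps)
    qed
  qed
  then show ?thesis by auto
qed

text \<open>Zorn's lemma gives a maximal dominated graph above that of \<open>f\<close>. The
  one-dimensional extension shows that its domain is the whole space.\<close>

theorem hahn_banach_dominated:
  fixes p f :: "'a::real_vector \<Rightarrow> real"
  assumes subadd: "\<And>x y. p (x + y) \<le> p x + p y"
    and homog: "\<And>t x. t > 0 \<Longrightarrow> p (t *\<^sub>R x) = t * p x"
    and S: "subspace S"
    and f_add: "\<And>x y. x \<in> S \<Longrightarrow> y \<in> S \<Longrightarrow> f (x + y) = f x + f y"
    and f_scale: "\<And>r x. x \<in> S \<Longrightarrow> f (r *\<^sub>R x) = r * f x"
    and f_le: "\<And>x. x \<in> S \<Longrightarrow> f x \<le> p x"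
  obtains F where "linear F" "\<And>x. x \<in> S \<Longrightarrow> F x = f x" "\<And>x. F x \<le> p x"
proof -
  have p0: "p 0 = 0" using homog[of 2 0] by simp
  define \<G> where "\<G> = {G. subspace G \<and> (\<lambda>x. (x, f x)) ` S \<subseteq> G \<and> (\<forall>(x, r)\<in>G. r \<le> p x)}"
  have "(\<lambda>x. (x, f x)) ` S \<in> \<G>"
  proof -
    have "subspace ((\<lambda>x. (x, f x)) ` S)"
      unfolding subspace_def
    proof safe
      show "0 \<in> (\<lambda>x. (x, f x)) ` S"
        using subspace_0[OF S] f_scale[of 0 0] by (auto simp: zero_prod_def image_iff)
    qed (auto simp: image_iff f_add f_scale subspace_add[OF S] subspace_scale[OF S])
    then show ?thesis by (auto simp: \<G>_def f_le)
  qed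
  moreover have "\<Union>\<C> \<in> \<G>" if "\<C> \<noteq> {}" and ch: "subset.chain \<G> \<C>" for \<C>
  proof -
    have sub: "\<C> \<subseteq> \<G>" and lin: "\<And>X Y. X \<in> \<C> \<Longrightarrow> Y \<in> \<C> \<Longrightarrow> X \<subseteq> Y \<or> Y \<subseteq> X"
      using ch by (auto simp: subset_chain_def)
    have ss: "\<And>X. X \<in> \<C> \<Longrightarrow> subspace X" using sub by (auto simp: \<G>_def)
    have "subspace (\<Union>\<C>)"
      unfolding subspace_def
    proof safe
      show "0 \<in> \<Union>\<C>" using that(1) ss subspace_0 by blast
    next
      fix x y X Y assume "x \<in> X" "X \<in> \<C>" "y \<in> Y" "Y \<in> \<C>"
      then show "x + y \<in> \<Union>\<C>" using lin[of X Y] ss subspace_add by blast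
    next
      fix c x X assume "x \<in> X" "X \<in> \<C>"
      then show "c *\<^sub>R x \<in> \<Union>\<C>" using ss subspace_scale by blast
    qed
    then show ?thesis using sub that(1) by (fastforce simp: \<G>_def)
  qed
  ultimately obtain M where M: "M \<in> \<G>" and max: "\<And>X. X \<in> \<G> \<Longrightarrow> M \<subseteq> X \<Longrightarrow> X = M"
    using subset_Zorn_nonempty[of \<G>] by blast
  have Ms: "subspace M" and Mf: "\<And>x. x \<in> S \<Longrightarrow> (x, f x) \<in> M"
    and Mp: "\<And>x r. (x, r) \<in> M \<Longrightarrow> r \<le> p x"
    using M by (auto simp: \<G>_def)
  have uniq: "\<And>x r s. (x, r) \<in> M \<Longrightarrow> (x, s) \<in> M \<Longrightarrow> r = s"
    by (rule dominated_graph_unique[of M p, OF Ms Mp p0])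
  have total: "\<exists>r. (x, r) \<in> M" for x
  proof -
    obtain c where c: "\<forall>(y, r)\<in>span (insert (x, c) M). r \<le> p y"
      using dominated_graph_extend[of p M x, OF subadd homog Ms Mp] by blast
    have sup: "insert (x, c) M \<subseteq> span (insert (x, c) M)" by (rule span_superset)
    have "span (insert (x, c) M) \<in> \<G>"
      using sup Mf c by (auto simp: \<G>_def)
    from max[OF this] sup show ?thesis by auto
  qed
  define F where "F x = (THE r. (x, r) \<in> M)" for x
  have FM: "(x, F x) \<in> M" for x
    unfolding F_def using total uniq by (metis the_equality)
  have Feq: "F x = r" if "(x, r) \<in> M" for x r using uniq FM that by blast
  show thesis
  proof
    show "linear F"
    proof (rule linearI)
      show "F (x + y) = F x + F y" for x y
        using subspace_add[OF Ms FM[of x] FM[of y]] by (intro Feq) simp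
      show "F (r *\<^sub>R x) = r *\<^sub>R F x" for r x
        using subspace_scale[OF Ms FM[of x], of r] by (intro Feq) simp
    qed
    show "F x = f x" if "x \<in> S" for x using Feq Mf that by blast
    show "F x \<le> p x" for x using FM Mp by blast
  qed
qed

section \<open>Square roots and norm estimates in \<open>C\<^sup>*\<close>-algebras\<close>

lemma star_one [simp]: "star (1::'a::unital_cstar_algebra) = 1"
  by (metis mult_1_left star_mult star_star mult_1_right)

lemma star_scaleR: "star (r *\<^sub>R x) = r *\<^sub>R star (x::'a::unital_cstar_algebra)"
  by (simp add: scaleR_scaleC star_scaleC)

lemma linear_star: "linear (star :: 'a::unital_cstar_algebra \<Rightarrow> 'a)"
  by (rule linearI) (simp_all add: star_add star_scaleR)

lemmas star_linear_simps = star_add star_scaleR linear_0[OF linear_star] linear_neg[OF linear_star]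
  linear_diff[OF linear_star]

lemma scaleC_zero [simp]: "c *\<^sub>C (0::'a::unital_cstar_algebra) = 0"
  using scaleC_add_right[of c 0 "0::'a"] by simp

lemma scaleC_diff_right: "c *\<^sub>C (x - y) = c *\<^sub>C x - c *\<^sub>C (y::'a::unital_cstar_algebra)"
  using scaleC_add_right[of c "x - y" y] by simp

text \<open>The norm of 1 equals its own square, hence is 0 or 1; the value 0 occurs in the zero
  algebra.\<close>

lemma norm_one_le: "norm (1::'a::unital_cstar_algebra) \<le> 1"
proof -
  have "norm (1::'a) = (norm (1::'a))\<^sup>2" using cstar_identity[of "1::'a"] by simp
  then show ?thesis by (metis power2_eq_square mult_cancel_right1 order_refl zero_le_one)
qed

lemma norm_star: "norm (star x) = norm (x::'a::unital_cstar_algebra)"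
proof -
  have *: "norm y \<le> norm (star y)" for y :: 'a
  proof (cases "norm y = 0")
    case False
    have "norm y * norm y \<le> norm (star y) * norm y"
      using cstar_identity[of y] norm_mult_ineq[of "star y" y] by (simp add: power2_eq_square)
    then show ?thesis using False by simp
  qed simp
  show ?thesis using *[of x] *[of "star x"] by (simp add: star_star)
qed

lemma continuous_on_star: "continuous_on UNIV (star :: 'a::unital_cstar_algebra \<Rightarrow> 'a)"
proof -
  have "bounded_linear (star :: 'a \<Rightarrow> 'a)"
    by (intro bounded_linear.intro bounded_linear_axioms.intro linear_star exI[of _ 1])
       (simp add: norm_star)
  then show ?thesis by (simp add: linear_continuous_on)
qed

lemma closed_selfadjoint: "closed (selfadjoint :: 'a::unital_cstar_algebra set)"
  unfolding selfadjoint_def using closed_Collect_eq[OF continuous_on_star continuous_on_id] by simp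

lemma subspace_selfadjoint: "subspace (selfadjoint :: 'a::unital_cstar_algebra set)"
  by (auto simp: subspace_def selfadjoint_def star_linear_simps)

section \<open>Square roots by the binomial series\<close>

lemma norm_power_le:
  "norm ((a::'a::unital_cstar_algebra) ^ n) \<le> norm a ^ n"
proof (induction n)
  case 0
  show ?case using norm_one_le by simp
next
  case (Suc n)
  have "norm (a ^ Suc n) \<le> norm a * norm (a ^ n)" using norm_mult_ineq by simp
  also have "\<dots> \<le> norm a ^ Suc n" using Suc by (simp add: mult_left_mono)
  finally show ?case .
qed

text \<open>The binomial series of (1 - a)^(1/2) converges absolutely. Its partial sums are linear
  combinations of powers of \<open>a\<close>, so they lie in \<open>S\<close>, and closedness keeps
  the limit there.\<close>

lemma sqrt_one_minus_in:
  fixes a :: "'a::unital_cstar_algebra"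
  assumes "closed S" "subspace S" and pow: "\<And>n. a ^ n \<in> S" and "norm a < 1"
  obtains b where "b \<in> S" "b * b = 1 - a"
proof -
  define c where "c n = ((1/2::real) gchoose n) * (-1) ^ n" for n
  define t where "t n = c n *\<^sub>R a ^ n" for n
  have "ereal (norm (norm a)) < conv_radius (\<lambda>n. (1/2::real) gchoose n)"
    using assms(4) by (simp add: conv_radius_gchoose)
  from abs_summable_in_conv_radius[OF this]
  have "summable (\<lambda>n. \<bar>c n\<bar> * norm a ^ n)"
    by (simp add: c_def abs_mult power_abs)
  then have sn: "summable (\<lambda>n. norm (t n))"
    by (rule summable_comparison_test'[where N = 0])
       (simp add: t_def mult_left_mono norm_power_le)
  define b where "b = (\<Sum>n. t n)"
  have "(\<lambda>n. \<Sum>i<n. t i) \<longlonglongrightarrow> b"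
    using summable_LIMSEQ[OF summable_norm_cancel[OF sn]] by (simp add: b_def)
  moreover have "(\<Sum>i<n. t i) \<in> S" for n
    unfolding t_def by (intro subspace_sum subspace_scale assms pow)
  ultimately have "b \<in> S" by (rule closed_sequentially[OF assms(1), rotated])
  moreover have "b * b = 1 - a"
  proof -
    \<comment> \<open>Vandermonde's identity with 1/2 + 1/2 = 1: the Cauchy square of the series has
      the coefficients of (1 - x)^1, which vanish from degree 2 on.\<close>
    have conv: "(\<Sum>i\<le>k. c i * c (k - i)) = (1 gchoose k) * (-1) ^ k" for k
    proof -
      have "c i * c (k - i) = ((1/2) gchoose i) * ((1/2) gchoose (k - i)) * (-1) ^ k"
        if "i \<le> k" for i
      proof -
        have "(-1) ^ k = (-1) ^ i * (-1 :: real) ^ (k - i)"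
          using that by (metis power_add le_add_diff_inverse)
        then show ?thesis by (simp only: c_def mult_ac)
      qed
      then have "(\<Sum>i\<le>k. c i * c (k - i))
          = (\<Sum>i=0..k. ((1/2) gchoose i) * ((1/2) gchoose (k - i))) * (-1) ^ k"
        unfolding sum_distrib_right atLeast0AtMost by (intro sum.cong) auto
      then show ?thesis by (simp add: gbinomial_Vandermonde)
    qed
    have "t i * t (k - i) = (c i * c (k - i)) *\<^sub>R a ^ k" if "i \<le> k" for i k
    proof -
      have "a ^ k = a ^ i * a ^ (k - i)" using that by (metis power_add le_add_diff_inverse)
      then show ?thesis by (simp add: t_def mult.commute)
    qed
    then have "(\<Sum>i\<le>k. t i * t (k - i)) = (\<Sum>i\<le>k. c i * c (k - i)) *\<^sub>R a ^ k" for k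
      unfolding scaleR_sum_left by (intro sum.cong) auto
    then have eq: "(\<Sum>i\<le>k. t i * t (k - i)) = ((1 gchoose k) * (-1) ^ k) *\<^sub>R a ^ k" for k
      by (simp only: conv)
    have "(\<lambda>k. ((1 gchoose k) * (-1) ^ k) *\<^sub>R a ^ k) sums (b * b)"
      using Cauchy_product_sums[OF sn sn] by (simp only: eq b_def)
    moreover have "(\<lambda>k. ((1 gchoose k) * (-1) ^ k) *\<^sub>R a ^ k) sums
        (\<Sum>k\<in>{0,1}. ((1 gchoose k) * (-1) ^ k) *\<^sub>R a ^ k)"
    proof (rule sums_finite)
      fix k :: nat assume "k \<notin> {0,1}"
      then have "(1::real) gchoose k = 0"
        using binomial_gbinomial[of 1 k, where ?'a = real] by (simp add: binomial_eq_0)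
      then show "((1 gchoose k) * (-1) ^ k) *\<^sub>R a ^ k = 0" by simp
    qed simp
    ultimately show ?thesis by (auto dest: sums_unique2)
  qed
  ultimately show thesis by (rule that)
qed

lemma norm_one_minus_square_le:
  fixes a :: "'a::unital_cstar_algebra"
  assumes sa: "star a = a" and "norm a < 1"
  shows "norm (1 - a * a) \<le> 1"
proof -
  \<comment> \<open>This closed subspace contains all powers of \<open>a * a\<close>. Taking the
    square root inside it makes \<open>b\<close> self-adjoint and commuting with \<open>a\<close>,
    as \<open>star u * u = 1\<close> requires.\<close>
  define S where "S = {x :: 'a. star x = x} \<inter> {x. x * a = a * x}"
  have cl: "closed S"
    unfolding S_def
    by (intro closed_Int closed_Collect_eq continuous_on_star continuous_intros)
  have sub: "subspace S"
    by (auto simp: S_def subspace_def star_linear_simps algebra_simps)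
  have star_pow: "star ((a * a) ^ n) = (a * a) ^ n" and comm: "(a * a) ^ n * a = a * (a * a) ^ n" for n
  proof (induction n)
    case (Suc n)
    { case 1
      have "star ((a * a) ^ Suc n) = (a * a) ^ n * (a * a)" using Suc(1) sa by (simp add: star_mult)
      then show ?case by (simp add: power_commutes) }
    { case 2
      show ?case using Suc(2) by (simp add: mult.assoc) }
  qed auto
  have "norm (a * a) = (norm a)\<^sup>2" using cstar_identity[of a] sa by simp
  then have "norm (a * a) < 1" using assms(2) by (simp add: abs_square_less_1)
  then obtain b where "b \<in> S" and bb: "b * b = 1 - a * a"
    using sqrt_one_minus_in[OF cl sub, of "a * a"] star_pow comm by (auto simp: S_def)
  then have sb: "star b = b" and ba: "b * a = a * b" by (auto simp: S_def)
  have ii: "\<i> *\<^sub>C (\<i> *\<^sub>C x) = - x" for x :: 'a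
    using scaleR_scaleC[of "-1" x] by (simp add: scaleC_scaleC)
  have neg: "(- \<i>) *\<^sub>C x = - (\<i> *\<^sub>C x)" for x :: 'a
    using scaleR_scaleC[of "-1" "\<i> *\<^sub>C x"] by (simp add: scaleC_scaleC)
  define u where "u = a + \<i> *\<^sub>C b"
  have su: "star u = a - \<i> *\<^sub>C b"
    by (simp add: u_def star_add star_scaleC sa sb neg)
  have "star u * u = (a - \<i> *\<^sub>C b) * (a + \<i> *\<^sub>C b)"
    unfolding su by (simp only: u_def)
  \<comment> \<open>The mixed terms cancel because \<open>a\<close> and \<open>b\<close>
    commute.\<close>
  also have "\<dots> = a * a + b * b"
    by (simp add: algebra_simps mult_scaleC_left mult_scaleC_right scaleC_add_right scaleC_diff_right ii ba)
  finally have "star u * u = 1" by (simp add: bb)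
  then have "(norm u)\<^sup>2 \<le> 1" using cstar_identity[of u] norm_one_le[where ?'a = 'a] by simp
  then have nu: "norm u \<le> 1" by (simp add: abs_square_le_1)
  have "(2 * \<i>) *\<^sub>C b = u - star u"
  proof -
    have "(2 * \<i>) *\<^sub>C b = \<i> *\<^sub>C b + \<i> *\<^sub>C b" by (simp flip: scaleC_add_left)
    then show ?thesis unfolding su by (simp add: u_def)
  qed
  then have "2 * norm b \<le> norm u + norm (star u)"
    using norm_scaleC[of "2 * \<i>" b] norm_triangle_ineq4[of u "star u"] by (simp add: norm_mult)
  then have "norm b \<le> 1" using nu norm_star[of u] by simp
  moreover have "norm (1 - a * a) = (norm b)\<^sup>2"
    using cstar_identity[of b] sb bb by simp
  ultimately show ?thesis by (simp add: abs_square_le_1)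
qed

section \<open>Jordan products, and norm bounds against positivity\<close>

lemma jordan_prod_self [simp]: "jordan_prod a a = a * (a::'a::unital_cstar_algebra)"
proof -
  have "a * a + a * a = 2 *\<^sub>R (a * a)" by (simp add: scaleR_2)
  then show ?thesis by (simp add: jordan_prod_def)
qed

lemma jordan_prod_selfadjoint:
  "a \<in> selfadjoint \<Longrightarrow> b \<in> selfadjoint \<Longrightarrow> jordan_prod a b \<in> selfadjoint"
  by (auto simp: selfadjoint_def jordan_prod_def star_linear_simps star_mult add.commute)

lemma one_selfadjoint: "1 \<in> selfadjoint"
  by (simp add: selfadjoint_def)

text \<open>Since \<open>a\<close> commutes with its powers, the Jordan product of \<open>a\<close>
  and \<open>a ^ n\<close> is \<open>a ^ Suc n\<close>; closure under the Jordan product therefore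
  suffices.\<close>

lemma power_mem_jordan:
  fixes a :: "'a::unital_cstar_algebra"
  assumes "1 \<in> S" "\<And>x y. x \<in> S \<Longrightarrow> y \<in> S \<Longrightarrow> jordan_prod x y \<in> S" "a \<in> S"
  shows "a ^ n \<in> S"
proof (induction n)
  case (Suc n)
  have "jordan_prod a (a ^ n) = (1/2) *\<^sub>R (2 *\<^sub>R a ^ Suc n)"
    unfolding jordan_prod_def by (simp only: power_commutes power_Suc scaleR_2)
  then show ?case using assms(2)[OF assms(3) Suc] by simp
qed (simp add: assms)

text \<open>Formulated for a closed unital Jordan subalgebra \<open>S\<close>, so that it applies
  both to all self-adjoint elements and to a state of the quotient pulled back to the
  normalizer.\<close>

lemma state_le_norm:
  fixes S :: "'a::unital_cstar_algebra set"
  assumes "closed S" and S: "subspace S" and "1 \<in> S"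
    and jordan: "\<And>x y. x \<in> S \<Longrightarrow> y \<in> S \<Longrightarrow> jordan_prod x y \<in> S"
    and f_add: "\<And>x y. x \<in> S \<Longrightarrow> y \<in> S \<Longrightarrow> f (x + y) = f x + f y"
    and f_scale: "\<And>r x. x \<in> S \<Longrightarrow> f (r *\<^sub>R x) = r * f x"
    and f_one: "f 1 = 1" and f_pos: "\<And>x. x \<in> S \<Longrightarrow> 0 \<le> f (jordan_prod x x)"
    and a: "a \<in> S"
  shows "f a \<le> norm a"
proof (rule ccontr)
  assume less: "\<not> f a \<le> norm a"
  \<comment> \<open>A value strictly between \<open>norm a\<close> and \<open>f a\<close>: after
    division by \<open>t\<close> the element has norm below 1 but \<open>f\<close>-value above 1, so
    \<open>1 - x\<close> is a square on which \<open>f\<close> is negative.\<close>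
  define t where "t = (f a + norm a) / 2"
  have t: "norm a < t" "t < f a" "t > 0"
    using less norm_ge_zero[of a] by (simp_all add: t_def not_le del: norm_ge_zero)
  define x where "x = (1/t) *\<^sub>R a"
  have x: "x \<in> S" unfolding x_def by (rule subspace_scale[OF S a])
  have "norm x < 1" using t by (simp add: x_def)
  then obtain b where b: "b \<in> S" "b * b = 1 - x"
    using sqrt_one_minus_in[OF assms(1) S power_mem_jordan[OF assms(3) jordan x]] by blast
  have "f (1 - x) = 1 - f a / t"
    using f_add[OF \<open>1 \<in> S\<close> subspace_neg[OF S x]] f_scale[OF x, of "-1"] f_scale[OF a, of "1/t"]
    by (simp add: f_one x_def)
  also have "\<dots> < 0" using t by simp
  finally show False using f_pos[OF b(1)] b(2) by simp
qed

text \<open>A converse to the norm bound: if \<open>norm x < 1\<close>, then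
  \<open>1 - x * x\<close> stays in the unit ball, so \<open>F\<close> is at most 1 there. Scaling
  covers the general case.\<close>

lemma dominated_functional_square_nonneg:
  fixes F :: "'a::unital_cstar_algebra \<Rightarrow> real"
  assumes F: "linear F" and le: "\<And>x. F x \<le> norm x" and one: "F 1 = 1" and sa: "star a = a"
  shows "0 \<le> F (a * a)"
proof -
  \<comment> \<open>The summand 1 makes \<open>t\<close> exceed \<open>norm a\<close> strictly and
    keeps it positive for \<open>a = 0\<close>.\<close>
  define t where "t = norm a + 1"
  have t: "t > 0" "norm a < t" by (auto simp: t_def add_nonneg_pos)
  define x where "x = (1/t) *\<^sub>R a"
  have "star x = x" "norm x < 1" using sa t by (auto simp: x_def star_scaleR)
  then have "F (1 - x * x) \<le> 1"
    using norm_one_minus_square_le le[of "1 - x * x"] by (meson order_trans)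
  then have "0 \<le> F (x * x)" by (simp add: linear_diff[OF F] one)
  moreover have "a * a = (t * t) *\<^sub>R (x * x)" using t by (simp add: x_def)
  ultimately show ?thesis by (simp add: linear_scale[OF F])
qed

section \<open>The normalizer and its quotient\<close>

lemma closed_of_closedin_selfadjoint:
  "closedin (top_of_set selfadjoint) (J :: 'a::unital_cstar_algebra set) \<Longrightarrow> closed J"
  using closedin_closed_trans closed_selfadjoint by blast

lemma lie_bracket_add_left: "lie_bracket lam (a + b) c = lie_bracket lam a c + lie_bracket lam b c"
  unfolding lie_bracket_def scaleC_add_right[symmetric] by (simp add: algebra_simps)

lemma scaleC_scaleR_commute: "c *\<^sub>C (r *\<^sub>R x) = r *\<^sub>R (c *\<^sub>C (x::'a::unital_cstar_algebra))"
  by (simp add: scaleR_scaleC scaleC_scaleC mult.commute)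

lemma lie_bracket_scale_left: "lie_bracket lam (r *\<^sub>R a) c = r *\<^sub>R lie_bracket lam a c"
  unfolding lie_bracket_def scaleC_scaleR_commute[symmetric] by (simp add: algebra_simps)

text \<open>Leibniz rule: bracketing with \<open>c\<close> is a derivation of the Jordan
  product.\<close>

lemma lie_bracket_jordan_prod:
  "lie_bracket lam (jordan_prod a b) c
     = jordan_prod a (lie_bracket lam b c) + jordan_prod b (lie_bracket lam a c)"
  unfolding lie_bracket_def jordan_prod_def
  by (simp add: mult_scaleC_left mult_scaleC_right scaleC_add_right scaleC_diff_right
      scaleC_scaleR_commute algebra_simps)

lemma continuous_on_lie_bracket:
  "continuous_on UNIV (\<lambda>a. lie_bracket lam a (c::'a::unital_cstar_algebra))"
proof -
  have "linear (\<lambda>x::'a. k *\<^sub>C x)" for k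
    by (rule linearI) (simp_all add: scaleC_add_right scaleC_scaleR_commute)
  then have bl: "bounded_linear (\<lambda>x::'a. k *\<^sub>C x)" for k
    by (intro bounded_linear.intro bounded_linear_axioms.intro exI[of _ "cmod k"])
       (simp_all add: norm_scaleC mult.commute)
  show ?thesis
    unfolding lie_bracket_def by (intro bounded_linear.continuous_on[OF bl] continuous_intros)
qed

context
  fixes lam :: real and J :: "'a::unital_cstar_algebra set"
  assumes J: "jordan_ideal J"
begin

lemma subspace_J: "subspace J"
  using J by (simp add: jordan_ideal_def)

lemma jordan_prod_ideal: "a \<in> selfadjoint \<Longrightarrow> j \<in> J \<Longrightarrow> jordan_prod a j \<in> J"
  using J by (simp add: jordan_ideal_def)

lemma normalizer_selfadjoint: "a \<in> normalizer lam J \<Longrightarrow> a \<in> selfadjoint"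
  by (simp add: normalizer_def)

lemma subspace_normalizer: "subspace (normalizer lam J)"
  using subspace_selfadjoint[where ?'a = 'a] subspace_J
  by (auto simp: subspace_def normalizer_def lie_bracket_add_left lie_bracket_scale_left
      lie_bracket_def[of lam 0])

lemma one_normalizer: "1 \<in> normalizer lam J"
  using subspace_0[OF subspace_J] by (auto simp: normalizer_def one_selfadjoint lie_bracket_def)

text \<open>By the Leibniz rule the bracket with \<open>j\<close> is a sum of Jordan products of
  self-adjoint elements with brackets in \<open>J\<close>, and \<open>J\<close> absorbs
  these.\<close>

lemma jordan_prod_normalizer:
  "a \<in> normalizer lam J \<Longrightarrow> b \<in> normalizer lam J \<Longrightarrow> jordan_prod a b \<in> normalizer lam J"
  by (auto simp: normalizer_def jordan_prod_selfadjoint lie_bracket_jordan_prod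
      intro!: subspace_add[OF subspace_J] jordan_prod_ideal)

text \<open>Closedness keeps the binomial square roots inside the normalizer.\<close>

lemma closed_normalizer:
  assumes "closed J"
  shows "closed (normalizer lam J)"
proof -
  have "normalizer lam J = selfadjoint \<inter> (\<Inter>j\<in>J. (\<lambda>a. lie_bracket lam a j) -` J)"
    by (auto simp: normalizer_def)
  moreover have "closed ((\<lambda>a. lie_bracket lam a j) -` J)" for j
    using continuous_closed_vimage[OF assms, of "\<lambda>a. lie_bracket lam a j"]
      continuous_on_lie_bracket[of lam j]
    by (simp add: continuous_on_eq_continuous_at)
  ultimately show ?thesis using closed_selfadjoint by (simp only:) (intro closed_Int closed_INT ballI)
qed

lemma subspace_kernel: "subspace (normalizer lam J \<inter> J)"
  by (intro subspace_inter subspace_normalizer subspace_J)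

section \<open>Cosets and the induced operations\<close>

lemma coset_memD: "x \<in> coset lam J a \<Longrightarrow> x - a \<in> normalizer lam J \<inter> J"
  by (auto simp: coset_def)

lemma coset_self: "a \<in> coset lam J a"
  using subspace_0[OF subspace_kernel] by (auto simp: coset_def image_iff)

lemma coset_eqI:
  assumes "x - y \<in> normalizer lam J \<inter> J"
  shows "coset lam J x = coset lam J y"
proof -
  have sub: "coset lam J x \<subseteq> coset lam J y" if "x - y \<in> normalizer lam J \<inter> J" for x y
  proof
    fix z assume z: "z \<in> coset lam J x"
    have "z - y \<in> normalizer lam J \<inter> J"
      using subspace_add[OF subspace_kernel coset_memD[OF z] that] by simp
    then show "z \<in> coset lam J y" unfolding coset_def by (intro image_eqI[of _ _ "z - y"]) auto
  qed
  show ?thesis using sub[OF assms] sub[of y x] subspace_neg[OF subspace_kernel assms] by simp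
qed

text \<open>All pairs of representatives yield the same coset, and \<open>a\<close>,
  \<open>b\<close> themselves form such a pair, so the union is exactly one coset.\<close>

lemma coset_Union_eqI:
  assumes "\<And>x y. x \<in> coset lam J a \<Longrightarrow> y \<in> coset lam J b \<Longrightarrow> h x y - h a b \<in> normalizer lam J \<inter> J"
  shows "(\<Union>x\<in>coset lam J a. \<Union>y\<in>coset lam J b. coset lam J (h x y)) = coset lam J (h a b)"
  using coset_eqI[OF assms] coset_self[of a] coset_self[of b] by blast

lemma reduced_carrier: "lj_carrier (reduced_algebra lam J) = coset lam J ` normalizer lam J"
  by (simp add: reduced_algebra_def)

lemma reduced_unit: "lj_unit (reduced_algebra lam J) = coset lam J 1"
  by (simp add: reduced_algebra_def)

lemma reduced_add:
  "lj_add (reduced_algebra lam J) (coset lam J a) (coset lam J b) = coset lam J (a + b)"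
proof -
  have "x + y - (a + b) \<in> normalizer lam J \<inter> J" if "x \<in> coset lam J a" "y \<in> coset lam J b" for x y
    using subspace_add[OF subspace_kernel coset_memD[OF that(1)] coset_memD[OF that(2)]]
    by (simp add: algebra_simps)
  from coset_Union_eqI[of _ _ "(+)", OF this] show ?thesis by (simp add: reduced_algebra_def)
qed

lemma reduced_scale:
  "lj_scale (reduced_algebra lam J) r (coset lam J a) = coset lam J (r *\<^sub>R a)"
proof -
  have "coset lam J (r *\<^sub>R x) = coset lam J (r *\<^sub>R a)" if "x \<in> coset lam J a" for x
    using subspace_scale[OF subspace_kernel coset_memD[OF that], of r]
    by (intro coset_eqI) (simp add: algebra_simps)
  then have "(\<Union>x\<in>coset lam J a. coset lam J (r *\<^sub>R x)) = coset lam J (r *\<^sub>R a)"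
    using coset_self[of a] by blast
  then show ?thesis by (simp add: reduced_algebra_def)
qed

lemma reduced_jordan:
  assumes a: "a \<in> normalizer lam J" and b: "b \<in> normalizer lam J"
  shows "lj_jordan (reduced_algebra lam J) (coset lam J a) (coset lam J b)
    = coset lam J (jordan_prod a b)"
proof -
  have "jordan_prod x y - jordan_prod a b \<in> normalizer lam J \<inter> J"
    if x: "x \<in> coset lam J a" and y: "y \<in> coset lam J b" for x y
  proof -
    have k: "x - a \<in> normalizer lam J \<inter> J" and l: "y - b \<in> normalizer lam J \<inter> J"
      using x y coset_memD by auto
    have yN: "y \<in> normalizer lam J"
      using subspace_add[OF subspace_normalizer, of "y - b" b] l b by simp
    \<comment> \<open>Changing one factor at a time leaves Jordan products of a normalizer element
      with a kernel element; these lie in the normalizer and in the ideal.\<close>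
    have "jordan_prod x y - jordan_prod a b = jordan_prod y (x - a) + jordan_prod a (y - b)"
      unfolding jordan_prod_def scaleR_add_right[symmetric] scaleR_diff_right[symmetric]
      by (simp add: algebra_simps)
    moreover have "jordan_prod y (x - a) \<in> normalizer lam J \<inter> J"
        "jordan_prod a (y - b) \<in> normalizer lam J \<inter> J"
      using k l a yN by (auto intro: jordan_prod_normalizer jordan_prod_ideal normalizer_selfadjoint)
    ultimately show ?thesis using subspace_add[OF subspace_kernel] by simp
  qed
  from coset_Union_eqI[of _ _ jordan_prod, OF this] show ?thesis
    by (simp add: reduced_algebra_def)
qed

section \<open>States\<close>

lemma states_sa_iff:
  fixes \<omega> :: "'a \<Rightarrow> real"
  shows "\<omega> \<in> states (sa_algebra lam) \<longleftrightarrow> \<omega> \<in> extensional selfadjoint \<and>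
     (\<forall>x\<in>selfadjoint. \<forall>y\<in>selfadjoint. \<omega> (x + y) = \<omega> x + \<omega> y) \<and>
     (\<forall>r. \<forall>x\<in>selfadjoint. \<omega> (r *\<^sub>R x) = r * \<omega> x) \<and>
     \<omega> 1 = 1 \<and> (\<forall>x\<in>selfadjoint. 0 \<le> \<omega> (jordan_prod x x))"
  by (simp add: states_def linear_functionals_def sa_algebra_def)

text \<open>Translates the state conditions on cosets into conditions on the pulled-back functional
  on the normalizer.\<close>

lemma states_reduced_iff:
  "\<rho> \<in> states (reduced_algebra lam J) \<longleftrightarrow> \<rho> \<in> extensional (coset lam J ` normalizer lam J) \<and>
     (\<forall>x\<in>normalizer lam J. \<forall>y\<in>normalizer lam J.
        \<rho> (coset lam J (x + y)) = \<rho> (coset lam J x) + \<rho> (coset lam J y)) \<and>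
     (\<forall>r. \<forall>x\<in>normalizer lam J. \<rho> (coset lam J (r *\<^sub>R x)) = r * \<rho> (coset lam J x)) \<and>
     \<rho> (coset lam J 1) = 1 \<and> (\<forall>x\<in>normalizer lam J. 0 \<le> \<rho> (coset lam J (jordan_prod x x)))"
  by (simp add: states_def linear_functionals_def reduced_carrier reduced_unit reduced_add
      reduced_scale reduced_jordan del: jordan_prod_self)

lemma abs_state_le_norm:
  fixes \<omega> :: "'a \<Rightarrow> real"
  assumes "\<omega> \<in> states (sa_algebra lam)" "a \<in> selfadjoint"
  shows "\<bar>\<omega> a\<bar> \<le> norm a"
proof -
  have *: "\<omega> x \<le> norm x" if "x \<in> selfadjoint" for x :: 'a
    using assms(1) that unfolding states_sa_iff
    by (intro state_le_norm[OF closed_selfadjoint subspace_selfadjoint one_selfadjoint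
          jordan_prod_selfadjoint]) blast+
  have "\<omega> (- a) = - \<omega> a"
    using assms unfolding states_sa_iff by (metis mult_minus1 scaleR_minus1_left)
  then show ?thesis using *[OF assms(2)] *[OF subspace_neg[OF subspace_selfadjoint assms(2)]] by simp
qed

text \<open>States are bounded by the norm, so a difference of two is automatically in the dual;
  only vanishing on the normalizer remains.\<close>

lemma state_equiv_iff:
  assumes \<omega>: "\<omega> \<in> vanishing_states lam J" and \<omega>': "\<omega>' \<in> vanishing_states lam J"
  shows "(\<omega>, \<omega>') \<in> state_equiv lam J \<longleftrightarrow> (\<forall>a\<in>normalizer lam J. \<omega> a = \<omega>' a)"
proof -
  let ?d = "restrict (\<lambda>a. \<omega> a - \<omega>' a) selfadjoint"
  have s: "\<omega> \<in> states (sa_algebra lam)" "\<omega>' \<in> states (sa_algebra lam)"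
    using \<omega> \<omega>' by (auto simp: vanishing_states_def)
  have "?d \<in> linear_functionals (sa_algebra lam)"
    using s unfolding states_sa_iff
    by (auto simp: linear_functionals_def sa_algebra_def subspace_add[OF subspace_selfadjoint]
        subspace_scale[OF subspace_selfadjoint] algebra_simps)
  moreover have "\<bar>\<omega> x - \<omega>' x\<bar> \<le> 2 * norm x" if "x \<in> selfadjoint" for x
    using abs_state_le_norm[OF s(1) that] abs_state_le_norm[OF s(2) that] by linarith
  ultimately have "?d \<in> dual (sa_algebra lam)"
    by (auto simp: dual_def sa_algebra_def)
  then show ?thesis
    using \<omega> \<omega>' by (auto simp: state_equiv_def annihilator_def normalizer_selfadjoint)
qed

text \<open>The pulled-back state is dominated by the norm on the normalizer, and its dominated
  extension is positive. This makes the class attached to each reduced state nonempty.\<close>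

lemma reduced_state_lift:
  assumes cl: "closed J" and \<rho>: "\<rho> \<in> states (reduced_algebra lam J)"
  obtains \<omega> where "\<omega> \<in> vanishing_states lam J" "\<forall>a\<in>normalizer lam J. \<rho> (coset lam J a) = \<omega> a"
proof -
  let ?f = "\<lambda>a. \<rho> (coset lam J a)"
  have le: "?f a \<le> norm a" if "a \<in> normalizer lam J" for a
    using \<rho> that unfolding states_reduced_iff
    by (intro state_le_norm[where f = ?f, OF closed_normalizer[OF cl] subspace_normalizer
          one_normalizer jordan_prod_normalizer]) blast+
  obtain F where F: "linear F" "\<And>x. x \<in> normalizer lam J \<Longrightarrow> F x = ?f x" "\<And>x. F x \<le> norm x"
    using \<rho> unfolding states_reduced_iff
    by (rule_tac hahn_banach_dominated[of norm, OF norm_triangle_ineq _ subspace_normalizer _ _ le])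
       auto
  have F1: "F 1 = 1" using \<rho> F(2)[OF one_normalizer] by (simp add: states_reduced_iff)
  have zero: "F x = 0" if "x \<in> normalizer lam J \<inter> J" for x
  proof -
    have "coset lam J x = coset lam J 0" by (rule coset_eqI) (use that in simp)
    then have "F x = F 0" using F(2) that subspace_0[OF subspace_normalizer] by simp
    then show ?thesis by (simp add: linear_0[OF F(1)])
  qed
  have "restrict F selfadjoint \<in> states (sa_algebra lam)"
    using dominated_functional_square_nonneg[OF F(1,3) F1]
      jordan_prod_selfadjoint[where ?'a = 'a]
    unfolding states_sa_iff
    by (auto simp: F1 one_selfadjoint linear_add[OF F(1)] linear_scale[OF F(1)]
        subspace_add[OF subspace_selfadjoint] subspace_scale[OF subspace_selfadjoint])
       (auto simp: restrict_def selfadjoint_def star_mult)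
  then have "restrict F selfadjoint \<in> vanishing_states lam J"
    using zero by (auto simp: vanishing_states_def normalizer_selfadjoint)
  then show thesis
    by (rule that) (auto simp: F(2) normalizer_selfadjoint)
qed

text \<open>Vanishing on the kernel makes the state constant on each coset, so any choice of
  representative defines the functional on the quotient.\<close>

lemma vanishing_state_descends:
  assumes \<omega>: "\<omega> \<in> vanishing_states lam J"
  obtains \<rho> where "\<rho> \<in> states (reduced_algebra lam J)"
    "\<forall>a\<in>normalizer lam J. \<rho> (coset lam J a) = \<omega> a"
proof -
  have s: "\<omega> \<in> states (sa_algebra lam)" and van: "\<And>x. x \<in> normalizer lam J \<inter> J \<Longrightarrow> \<omega> x = 0"
    using \<omega> by (auto simp: vanishing_states_def)
  have const: "\<omega> x = \<omega> a" if a: "a \<in> normalizer lam J" and x: "x \<in> coset lam J a" for a x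
  proof -
    have "x - a \<in> selfadjoint" using coset_memD[OF x] normalizer_selfadjoint by blast
    then have "\<omega> (x - a + a) = \<omega> (x - a) + \<omega> a"
      using s normalizer_selfadjoint[OF a] unfolding states_sa_iff by blast
    then show ?thesis using van[OF coset_memD[OF x]] by simp
  qed
  define \<rho> where
    "\<rho> = restrict (\<lambda>X. \<omega> (SOME x. x \<in> X)) (coset lam J ` normalizer lam J)"
  have \<rho>: "\<rho> (coset lam J a) = \<omega> a" if "a \<in> normalizer lam J" for a
    using that const[OF that someI[of "\<lambda>x. x \<in> coset lam J a", OF coset_self]]
    by (simp add: \<rho>_def)
  have "\<rho> \<in> extensional (coset lam J ` normalizer lam J)" by (simp add: \<rho>_def)
  then have "\<rho> \<in> states (reduced_algebra lam J)"
    using s unfolding states_reduced_iff states_sa_iff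
    by (simp add: \<rho> subspace_add[OF subspace_normalizer] subspace_scale[OF subspace_normalizer]
        jordan_prod_normalizer one_normalizer normalizer_selfadjoint del: jordan_prod_self)
  then show thesis using that \<rho> by blast
qed

lemma reduced_state_eqI:
  assumes "\<rho> \<in> states (reduced_algebra lam J)" "\<rho>' \<in> states (reduced_algebra lam J)"
    and "\<And>a. a \<in> normalizer lam J \<Longrightarrow> \<rho> (coset lam J a) = \<rho>' (coset lam J a)"
  shows "\<rho> = \<rho>'"
  using assms unfolding states_reduced_iff
  by (intro extensionalityI[of \<rho> "coset lam J ` normalizer lam J" \<rho>']) auto

end

section \<open>The bijection between reduced states and classes\<close>

theorem theorem8:
  fixes lam :: real and J :: "'a::unital_cstar_algebra set"
  assumes "lam \<noteq> 0"
    and "jordan_ideal J"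
    and "closedin (top_of_set selfadjoint) J"
  shows "\<exists>\<Phi>. bij_betw \<Phi> (states (reduced_algebra lam J))
                (vanishing_states lam J // state_equiv lam J) \<and>
             (\<forall>\<omega>r \<in> states (reduced_algebra lam J). \<forall>\<omega> \<in> \<Phi> \<omega>r.
                \<forall>a \<in> normalizer lam J. \<omega>r (coset lam J a) = \<omega> a)"
proof -
  note J = assms(2)
  have cl: "closed J" using assms(3) by (rule closed_of_closedin_selfadjoint)
  \<comment> \<open>All vanishing states whose restriction to the normalizer is the pull-back of
    \<open>\<rho>\<close>.\<close>
  define \<Phi> where "\<Phi> \<rho> = {\<omega> \<in> vanishing_states lam J.
    \<forall>a\<in>normalizer lam J. \<rho> (coset lam J a) = \<omega> a}" for \<rho>
  \<comment> \<open>Equivalence only compares values on the normalizer, so any single member of this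
    set determines it as a full class.\<close>
  have class_eq: "\<Phi> \<rho> = state_equiv lam J `` {\<omega>}" if "\<omega> \<in> \<Phi> \<rho>" for \<rho> \<omega>
  proof -
    have \<omega>: "\<omega> \<in> vanishing_states lam J" "\<forall>a\<in>normalizer lam J. \<rho> (coset lam J a) = \<omega> a"
      using that by (auto simp: \<Phi>_def)
    have "\<omega>' \<in> \<Phi> \<rho> \<longleftrightarrow> (\<omega>, \<omega>') \<in> state_equiv lam J" for \<omega>'
    proof (cases "\<omega>' \<in> vanishing_states lam J")
      case True
      then show ?thesis using \<omega> state_equiv_iff[OF J \<omega>(1) True] by (simp add: \<Phi>_def)
    qed (auto simp: \<Phi>_def state_equiv_def)
    then show ?thesis by auto
  qed
  have lift: "\<exists>\<omega>. \<omega> \<in> \<Phi> \<rho>" if "\<rho> \<in> states (reduced_algebra lam J)" for \<rho>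
    using reduced_state_lift[OF J cl that] by (auto simp: \<Phi>_def)
  have "bij_betw \<Phi> (states (reduced_algebra lam J)) (vanishing_states lam J // state_equiv lam J)"
  proof (rule bij_betwI')
    fix \<rho> \<rho>' assume \<rho>: "\<rho> \<in> states (reduced_algebra lam J)" "\<rho>' \<in> states (reduced_algebra lam J)"
    show "\<Phi> \<rho> = \<Phi> \<rho>' \<longleftrightarrow> \<rho> = \<rho>'"
    proof
      assume "\<Phi> \<rho> = \<Phi> \<rho>'"
      \<comment> \<open>A common extension exists because the set is nonempty, and it fixes both
        reduced states on every coset.\<close>
      then obtain \<omega> where "\<omega> \<in> \<Phi> \<rho>" "\<omega> \<in> \<Phi> \<rho>'" using lift[OF \<rho>(1)] by auto
      then show "\<rho> = \<rho>'" by (intro reduced_state_eqI[OF J \<rho>]) (auto simp: \<Phi>_def)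
    qed simp
  next
    fix \<rho> assume "\<rho> \<in> states (reduced_algebra lam J)"
    then obtain \<omega> where \<omega>: "\<omega> \<in> \<Phi> \<rho>" using lift by blast
    then show "\<Phi> \<rho> \<in> vanishing_states lam J // state_equiv lam J"
      using class_eq[OF \<omega>] by (auto simp: quotient_def \<Phi>_def)
  next
    fix C assume "C \<in> vanishing_states lam J // state_equiv lam J"
    then obtain \<omega> where \<omega>: "\<omega> \<in> vanishing_states lam J" "C = state_equiv lam J `` {\<omega>}"
      by (auto simp: quotient_def)
    obtain \<rho> where \<rho>: "\<rho> \<in> states (reduced_algebra lam J)" "\<omega> \<in> \<Phi> \<rho>"
      using vanishing_state_descends[OF J \<omega>(1)] \<omega>(1) by (auto simp: \<Phi>_def)
    then show "\<exists>\<rho>\<in>states (reduced_algebra lam J). C = \<Phi> \<rho>" using class_eq \<omega>(2) by blast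
  qed
  then show ?thesis by (intro exI[of _ \<Phi>]) (auto simp: \<Phi>_def)
qed

end
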